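(* Let $A\in\mathbb{R}^{n\times n}$ and $D\in\mathbb{R}^{p\times p}$ be symmetric positive definite, let $B\in\mathbb{R}^{m\times n}$ have full row rank, let $C\in\mathbb{R}^{p\times n}$, let $P\in\mathbb{R}^{m\times m}$ be symmetric positive definite, and let $\tau>0$ and $\theta>0$ be real numbers. Let $\mu_{\min}$ and $\mu_{\max}$ be the minimum and maximum eigenvalues of $P^{-1}BA^{-1}B^T$, and let $\nu_{\max}$ be the maximum eigenvalue of $D^{-1}CA^{-1}C^T$. Set $$\mathcal{A}=\begin{pmatrix} A & B^T & C^T \\ B & 0 & 0 \\ C & 0 & -D \end{pmatrix},\qquad \mathcal{P}=\begin{pmatrix} A & 0 & 0 \\ B & -\frac{1}{\tau} P & 0 \\ C & 0 & -\frac{1}{\theta} D \end{pmatrix},$$ $$\underline{\Lambda}=\theta(1+\nu_{\max})+\tau\mu_{\min},\qquad \overline{\Lambda}=\theta(1+\nu_{\max})+\tau\mu_{\max}.$$ Then $\mathcal{P}^{-1}\mathcal{A}$ has eigenvalue $1$ with multiplicity at least $n$, and the remaining eigenvalues (that is, the other $m+p$ eigenvalues, counted with algebraic multiplicity) lie in the interval $$\left[\frac{\underline{\Lambda}-\sqrt{\underline{\Lambda}^2-4\tau\theta\mu_{\min}}}{2},\ \frac{\overline{\Lambda}+\sqrt{\overline{\Lambda}^2-4\tau\theta\mu_{\max}}}{2}\right].$$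
   Context: Eigenvalues of the $(n+m+p)\times(n+m+p)$ matrix $\mathcal{P}^{-1}\mathcal{A}$ are counted with algebraic multiplicity. The matrices $P^{-1}BA^{-1}B^T$ and $D^{-1}CA^{-1}C^T$ are similar to symmetric positive semidefinite matrices, so their eigenvalues are real. *)

theory Defs
  imports "HOL-Computational_Algebra.Computational_Algebra" "Jordan_Normal_Form.Spectral_Radius"
    "Jordan_Normal_Form.DL_Rank" "Jordan_Normal_Form.Gauss_Jordan_Elimination"
begin

definition spd_mat :: "nat \<Rightarrow> real mat \<Rightarrow> bool" where
  "spd_mat n A \<longleftrightarrow> A \<in> carrier_mat n n \<and> A\<^sup>T = A \<and>
     (\<forall>x \<in> carrier_vec n. x \<noteq> 0\<^sub>v n \<longrightarrow> 0 < x \<bullet> (A *\<^sub>v x))"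

(* Meaningful only for invertible A; otherwise the value is unspecified. *)
definition minv :: "'a::field mat \<Rightarrow> 'a mat" where
  "minv A = the (mat_inverse A)"

definition append_cols :: "'a::zero mat \<Rightarrow> 'a mat \<Rightarrow> 'a mat" (infixr \<open>@\<^sub>c\<close> 65) where
  "A @\<^sub>c B = four_block_mat A B (0\<^sub>m 0 (dim_col A)) (0\<^sub>m 0 (dim_col B))"

(* The arguments are the nine blocks, row by row. *)
definition block3_mat ::
  "'a::zero mat \<Rightarrow> 'a mat \<Rightarrow> 'a mat \<Rightarrow> 'a mat \<Rightarrow> 'a mat \<Rightarrow> 'a mat \<Rightarrow> 'a mat \<Rightarrow> 'a mat \<Rightarrow> 'a mat \<Rightarrow> 'a mat"
where
  "block3_mat A11 A12 A13 A21 A22 A23 A31 A32 A33 =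
     four_block_mat A11           (A12 @\<^sub>c A13)
                    (A21 @\<^sub>r A31) (four_block_mat A22 A23
                                                 A32 A33)"

(* All complex eigenvalues, with algebraic multiplicity, of a real square matrix. *)
definition eigvals_mset :: "real mat \<Rightarrow> complex multiset" where
  "eigvals_mset M = proots (char_poly (map_mat complex_of_real M))"

end

(*
  With F = (B; C) and W = diag(P/tau, D/theta), the preconditioned matrix is block upper triangular
  with diagonal blocks I and G = W^-1 H, where H = F A^-1 F^T + diag(0, D). So the eigenvalues other
  than the n ones are those of the symmetric pencil (H, W), hence real and nonnegative. Testing
  H v = l W v, v = (x, y), with (x, 0) and (0, y) compresses it to two scalar equations in the values
  of the quadratic forms at x and y. Eliminating the off-diagonal term by Cauchy-Schwarz for A^-1
  leaves a quadratic inequality for l in which only the Rayleigh quotients of P^-1 B A^-1 B^T and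
  D^-1 C A^-1 C^T occur.
*)

theory Submission
  imports Defs
begin

text \<open>With L = theta (1 + nu) + tau mu, the interval ends are roots of t^2 - L t + tau theta
  mu, the lower one for mu = mu_min and the upper one for mu = mu_max. This is the characteristic
  polynomial of the 2 by 2 matrix with diagonal entries tau mu and theta (1 + nu) and product of
  off-diagonal entries tau theta mu nu: the compressed problem when Cauchy-Schwarz is an equality
  and the two Rayleigh quotients are exactly mu and nu. Multiplicities are counted over the complex
  numbers, whereas \<open>Min\<close> and \<open>Max\<close> are taken over a real spectrum; hence a
  complex root must first be given a real eigenvector. The Rayleigh bounds come from completeness of
  the reals and Cauchy-Schwarz, without diagonalising anything. \<open>H\<close> is minus the Schur
  complement of \<open>A\<close> in \<open>AA\<close>, and \<open>W\<close> is minus the lower right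
  block of \<open>PP\<close>; the two signs cancel in \<open>G\<close>, which leaves a pencil with
  positive definite \<open>W\<close>.\<close>

section \<open>Symmetric forms and Cauchy-Schwarz\<close>

definition psd_mat :: "nat \<Rightarrow> real mat \<Rightarrow> bool" where
  "psd_mat n N \<longleftrightarrow> N \<in> carrier_mat n n \<and> N\<^sup>T = N \<and> (\<forall>x \<in> carrier_vec n. 0 \<le> x \<bullet> (N *\<^sub>v x))"

lemma spd_imp_psd: "spd_mat n N \<Longrightarrow> psd_mat n N"
  unfolding spd_mat_def psd_mat_def
proof (intro conjI ballI; elim conjE)
  fix x :: "real vec" assume N: "N \<in> carrier_mat n n" and x: "x \<in> carrier_vec n"
    and "\<forall>x\<in>carrier_vec n. x \<noteq> 0\<^sub>v n \<longrightarrow> 0 < x \<bullet> (N *\<^sub>v x)"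
  then show "0 \<le> x \<bullet> (N *\<^sub>v x)"
    by (cases "x = 0\<^sub>v n") (auto intro: less_imp_le)
qed auto

lemma smult_mat_mult_vec:
  fixes M :: "'a :: comm_semiring_0 mat"
  assumes "M \<in> carrier_mat k n" "v \<in> carrier_vec n"
  shows "(c \<cdot>\<^sub>m M) *\<^sub>v v = c \<cdot>\<^sub>v (M *\<^sub>v v)"
  using assms by (intro eq_vecI) (auto simp: scalar_prod_def sum_distrib_left mult.assoc intro!: sum.cong)

lemma scalar_mult_transpose:
  fixes M :: "'a :: comm_semiring_0 mat"
  assumes M: "M \<in> carrier_mat k n" and x: "x \<in> carrier_vec k" and y: "y \<in> carrier_vec n"
  shows "x \<bullet> (M *\<^sub>v y) = (M\<^sup>T *\<^sub>v x) \<bullet> y"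
  using transpose_vec_mult_scalar[OF M y x] M x y
    comm_scalar_prod[of x k "M *\<^sub>v y"] comm_scalar_prod[of y n "M\<^sup>T *\<^sub>v x"]
  by (metis mult_mat_vec_carrier transpose_carrier_mat)

lemma symmetric_form_commute:
  fixes M :: "'a :: comm_semiring_0 mat"
  assumes M: "M \<in> carrier_mat n n" "M\<^sup>T = M" and x: "x \<in> carrier_vec n" and y: "y \<in> carrier_vec n"
  shows "x \<bullet> (M *\<^sub>v y) = y \<bullet> (M *\<^sub>v x)"
  using scalar_mult_transpose[OF M(1) x y] M x y comm_scalar_prod[of "M *\<^sub>v x" n y]
  by (metis mult_mat_vec_carrier)

lemma form_lincomb:
  fixes M :: "real mat"
  assumes M: "M \<in> carrier_mat n n" "M\<^sup>T = M" and x: "x \<in> carrier_vec n" and y: "y \<in> carrier_vec n"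
  shows "(a \<cdot>\<^sub>v x + b \<cdot>\<^sub>v y) \<bullet> (M *\<^sub>v (a \<cdot>\<^sub>v x + b \<cdot>\<^sub>v y))
    = a\<^sup>2 * (x \<bullet> (M *\<^sub>v x)) + 2 * a * b * (x \<bullet> (M *\<^sub>v y)) + b\<^sup>2 * (y \<bullet> (M *\<^sub>v y))"
proof -
  have c: "M *\<^sub>v x \<in> carrier_vec n" "M *\<^sub>v y \<in> carrier_vec n" using M x y by auto
  have "M *\<^sub>v (a \<cdot>\<^sub>v x + b \<cdot>\<^sub>v y) = a \<cdot>\<^sub>v (M *\<^sub>v x) + b \<cdot>\<^sub>v (M *\<^sub>v y)"
    using M x y by (simp add: mult_add_distrib_mat_vec[of _ n n] mult_mat_vec)
  then show ?thesis
    using c x y symmetric_form_commute[OF M x y]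
    by (simp add: add_scalar_prod_distrib[of _ n] scalar_prod_add_distrib[of _ n]
        power2_eq_square algebra_simps)
qed

text \<open>The form of \<open>N\<close> on the plane spanned by \<open>x\<close> and
  \<open>y\<close> is a nonnegative binary quadratic form with coefficients p, 2b, q. Evaluating it
  at (q, -b) or (-b, p) gives q or p times the discriminant term. When p = q = 0, as
  semidefiniteness allows, the point (1, -b) gives -2 b^2 >= 0.\<close>

lemma psd_cauchy_schwarz:
  assumes N: "psd_mat n N" and x: "x \<in> carrier_vec n" and y: "y \<in> carrier_vec n"
  shows "(x \<bullet> (N *\<^sub>v y))\<^sup>2 \<le> (x \<bullet> (N *\<^sub>v x)) * (y \<bullet> (N *\<^sub>v y))"
proof -
  define p q b where "p = x \<bullet> (N *\<^sub>v x)" and "q = y \<bullet> (N *\<^sub>v y)" and "b = x \<bullet> (N *\<^sub>v y)"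
  have quad: "0 \<le> s\<^sup>2 * p + 2 * s * t * b + t\<^sup>2 * q" for s t
    using N x y form_lincomb[of N n x y s t]
    unfolding psd_mat_def p_def q_def b_def
    by (metis add_carrier_vec smult_carrier_vec)
  have nn: "0 \<le> p" "0 \<le> q" using quad[of 1 0] quad[of 0 1] by auto
  consider "0 < q" | "0 < p" | "p = 0" "q = 0" using nn by linarith
  then have "b\<^sup>2 \<le> p * q"
  proof cases
    case 1
    have "0 \<le> q * (p * q - b\<^sup>2)" using quad[of q "-b"] by (simp add: power2_eq_square algebra_simps)
    with 1 show ?thesis by (simp add: zero_le_mult_iff)
  next
    case 2
    have "0 \<le> p * (p * q - b\<^sup>2)" using quad[of "-b" p] by (simp add: power2_eq_square algebra_simps)
    with 2 show ?thesis by (simp add: zero_le_mult_iff)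
  next
    case 3
    then show ?thesis using quad[of 1 "-b"] by (simp add: power2_eq_square algebra_simps)
  qed
  then show ?thesis unfolding p_def q_def b_def .
qed

lemma form_le_const_sq:
  fixes M :: "real mat"
  assumes M: "M \<in> carrier_mat n n"
  obtains c where "0 < c" "\<And>x. x \<in> carrier_vec n \<Longrightarrow> x \<bullet> (M *\<^sub>v x) \<le> c * (x \<bullet> x)"
proof
  define c where "c = (\<Sum>i<n. \<Sum>j<n. \<bar>M $$ (i,j)\<bar>)"
  have c0: "0 \<le> c" unfolding c_def by (intro sum_nonneg) auto
  \<comment> \<open>The added 1 keeps the constant positive even for the zero matrix; later
    arguments divide by such constants.\<close>
  then show "0 < c + 1" by simp
  fix x :: "real vec" assume x: "x \<in> carrier_vec n"
  have xx: "x \<bullet> x = (\<Sum>i<n. (x $ i)\<^sup>2)"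
    using x by (simp add: scalar_prod_def atLeast0LessThan power2_eq_square)
  have le: "x $ i * M $$ (i,j) * x $ j \<le> \<bar>M $$ (i,j)\<bar> * (x \<bullet> x)" if "i < n" "j < n" for i j
  proof -
    have "(x $ i)\<^sup>2 \<le> x \<bullet> x" "(x $ j)\<^sup>2 \<le> x \<bullet> x"
      unfolding xx using that by (auto intro!: member_le_sum)
    moreover have "2 * \<bar>x $ i * x $ j\<bar> \<le> (x $ i)\<^sup>2 + (x $ j)\<^sup>2"
      using sum_squares_bound[of "\<bar>x $ i\<bar>" "\<bar>x $ j\<bar>"] by (simp add: abs_mult)
    ultimately have "\<bar>x $ i * x $ j\<bar> \<le> x \<bullet> x" by linarith
    then have "\<bar>M $$ (i,j)\<bar> * \<bar>x $ i * x $ j\<bar> \<le> \<bar>M $$ (i,j)\<bar> * (x \<bullet> x)"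
      by (intro mult_left_mono) auto
    moreover have "x $ i * M $$ (i,j) * x $ j \<le> \<bar>M $$ (i,j)\<bar> * \<bar>x $ i * x $ j\<bar>"
      using abs_ge_self[of "x $ i * M $$ (i,j) * x $ j"] by (simp add: abs_mult mult_ac)
    ultimately show ?thesis by linarith
  qed
  have "x \<bullet> (M *\<^sub>v x) = (\<Sum>i<n. \<Sum>j<n. x $ i * M $$ (i,j) * x $ j)"
    using x M by (auto simp: scalar_prod_def atLeast0LessThan sum_distrib_left mult.assoc
        intro!: sum.cong)
  also have "\<dots> \<le> (\<Sum>i<n. \<Sum>j<n. \<bar>M $$ (i,j)\<bar> * (x \<bullet> x))"
    by (intro sum_mono le) auto
  also have "\<dots> = c * (x \<bullet> x)" unfolding c_def by (simp add: sum_distrib_right)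
  also have "\<dots> \<le> (c + 1) * (x \<bullet> x)"
    unfolding xx by (intro mult_right_mono sum_nonneg) auto
  finally show "x \<bullet> (M *\<^sub>v x) \<le> (c + 1) * (x \<bullet> x)" .
qed

section \<open>Coercivity and Rayleigh bounds for symmetric pencils\<close>

lemma minv_props:
  assumes A: "(A :: 'a :: field mat) \<in> carrier_mat n n" and det: "det A \<noteq> 0"
  shows "minv A \<in> carrier_mat n n" "A * minv A = 1\<^sub>m n" "minv A * A = 1\<^sub>m n"
proof -
  have "A \<in> Units (ring_mat TYPE('a) n ())" by (rule det_non_zero_imp_unit[OF A det])
  then obtain B where "mat_inverse A = Some B"
    using mat_inverse(1)[OF A, of "()"] by (cases "mat_inverse A") auto
  with mat_inverse(2)[OF A this]
  show "minv A \<in> carrier_mat n n" "A * minv A = 1\<^sub>m n" "minv A * A = 1\<^sub>m n"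
    unfolding minv_def by auto
qed

text \<open>This replaces compactness of the unit sphere. With \<open>w\<close> the preimage of
  \<open>x\<close> under \<open>N\<close>, x.x is the value of the form of \<open>N\<close> at the
  pair \<open>x\<close>, \<open>w\<close>. Cauchy-Schwarz bounds its square by the form at
  \<open>x\<close> times w.x, and w.x is at most a constant times x.x, so one factor x.x
  cancels.\<close>

lemma psd_nonsingular_coercive:
  assumes N: "psd_mat n N" and det: "det N \<noteq> 0"
  obtains c where "0 < c" "\<And>x. x \<in> carrier_vec n \<Longrightarrow> x \<bullet> x \<le> c * (x \<bullet> (N *\<^sub>v x))"
proof -
  have Nc: "N \<in> carrier_mat n n" using N by (simp add: psd_mat_def)
  note Ni = minv_props[OF Nc det]
  obtain c where c: "0 < c" "\<And>x. x \<in> carrier_vec n \<Longrightarrow> x \<bullet> (minv N *\<^sub>v x) \<le> c * (x \<bullet> x)"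
    by (rule form_le_const_sq[OF Ni(1)]) blast
  show thesis
  proof (rule that[OF c(1)])
    fix x :: "real vec" assume x: "x \<in> carrier_vec n"
    define w where "w = minv N *\<^sub>v x"
    have w: "w \<in> carrier_vec n" and Nw: "N *\<^sub>v w = x"
      using Ni x Nc unfolding w_def by (auto simp flip: assoc_mult_mat_vec[of _ n n _ n])
    have p: "0 \<le> x \<bullet> (N *\<^sub>v x)" using N x by (simp add: psd_mat_def)
    have "(x \<bullet> x)\<^sup>2 \<le> (x \<bullet> (N *\<^sub>v x)) * (w \<bullet> x)"
      using psd_cauchy_schwarz[OF N x w] unfolding Nw .
    also have "w \<bullet> x = x \<bullet> (minv N *\<^sub>v x)"
      using comm_scalar_prod[OF w x] by (simp add: w_def)
    also have "(x \<bullet> (N *\<^sub>v x)) * \<dots> \<le> (x \<bullet> (N *\<^sub>v x)) * (c * (x \<bullet> x))"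
      by (intro mult_left_mono c x p)
    finally have *: "(x \<bullet> x) * (x \<bullet> x) \<le> (c * (x \<bullet> (N *\<^sub>v x))) * (x \<bullet> x)"
      by (simp add: power2_eq_square mult_ac)
    have "0 \<le> c * (x \<bullet> (N *\<^sub>v x))" using c(1) p by simp
    moreover have "0 \<le> x \<bullet> x" by (auto simp: scalar_prod_def intro!: sum_nonneg)
    ultimately show "x \<bullet> x \<le> c * (x \<bullet> (N *\<^sub>v x))"
      using * by (cases "x \<bullet> x = 0") (auto simp: mult_le_cancel_right)
  qed
qed

lemma spd_det_nonzero:
  assumes "spd_mat n A" shows "det A \<noteq> 0"
proof
  assume "det A = 0"
  then obtain v where v: "v \<in> carrier_vec n" "v \<noteq> 0\<^sub>v n" "A *\<^sub>v v = 0\<^sub>v n"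
    using det_0_iff_vec_prod_zero_field[of A n] assms by (auto simp: spd_mat_def)
  then have "v \<bullet> (A *\<^sub>v v) = 0" by simp
  with assms v show False by (auto simp: spd_mat_def)
qed

text \<open>The extremal value is the infimum of all \<open>t\<close> with \<open>t P - S\<close> positive semidefinite; a nonsingular
  positive semidefinite matrix is coercive, so at the infimum \<open>t P - S\<close> must be singular.\<close>

lemma max_eigenvalue_pencil:
  assumes S: "S \<in> carrier_mat m m" "S\<^sup>T = S" and P: "spd_mat m P" and m: "0 < m"
  obtains t v where "v \<in> carrier_vec m" "v \<noteq> 0\<^sub>v m" "S *\<^sub>v v = t \<cdot>\<^sub>v (P *\<^sub>v v)"
    "\<And>x. x \<in> carrier_vec m \<Longrightarrow> x \<bullet> (S *\<^sub>v x) \<le> t * (x \<bullet> (P *\<^sub>v x))"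
proof -
  have Pc: "P \<in> carrier_mat m m" "P\<^sup>T = P" using P by (auto simp: spd_mat_def)
  have Ppos: "0 < x \<bullet> (P *\<^sub>v x)" if "x \<in> carrier_vec m" "x \<noteq> 0\<^sub>v m" for x
    using P that by (auto simp: spd_mat_def)
  define T where "T = {t. \<forall>x \<in> carrier_vec m. x \<bullet> (S *\<^sub>v x) \<le> t * (x \<bullet> (P *\<^sub>v x))}"
  obtain c where c: "0 < c" "\<And>x. x \<in> carrier_vec m \<Longrightarrow> x \<bullet> (S *\<^sub>v x) \<le> c * (x \<bullet> x)"
    by (rule form_le_const_sq[OF S(1)]) blast
  obtain d where d: "0 < d" "\<And>x. x \<in> carrier_vec m \<Longrightarrow> x \<bullet> x \<le> d * (x \<bullet> (P *\<^sub>v x))"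
    by (rule psd_nonsingular_coercive[OF spd_imp_psd[OF P] spd_det_nonzero[OF P]]) blast
  have "c * d \<in> T"
    unfolding T_def
  proof (intro CollectI ballI)
    fix x :: "real vec" assume x: "x \<in> carrier_vec m"
    have "x \<bullet> (S *\<^sub>v x) \<le> c * (d * (x \<bullet> (P *\<^sub>v x)))"
      by (rule order.trans[OF c(2)[OF x] mult_left_mono]) (use c d x in auto)
    then show "x \<bullet> (S *\<^sub>v x) \<le> c * d * (x \<bullet> (P *\<^sub>v x))" by simp
  qed
  then have ne: "T \<noteq> {}" by auto
  have lower: "x \<bullet> (S *\<^sub>v x) / (x \<bullet> (P *\<^sub>v x)) \<le> t"
    if "t \<in> T" "x \<in> carrier_vec m" "x \<noteq> 0\<^sub>v m" for t x
    using that Ppos[OF that(2,3)] by (auto simp: T_def divide_le_eq)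
  \<comment> \<open>A nonzero vector exists because \<open>m\<close> is positive; its Rayleigh
    quotient is the lower bound that makes \<open>Inf T\<close> meaningful.\<close>
  have "unit_vec m 0 \<noteq> (0\<^sub>v m :: real vec)" using m by auto
  then have bdd: "bdd_below T" using lower[of _ "unit_vec m 0"] by (auto intro!: bdd_belowI)
  define t where "t = Inf T"
  have tT: "x \<bullet> (S *\<^sub>v x) \<le> t * (x \<bullet> (P *\<^sub>v x))" if x: "x \<in> carrier_vec m" for x
  proof (cases "x = 0\<^sub>v m")
    case True then show ?thesis using S Pc by simp
  next
    case False
    have "x \<bullet> (S *\<^sub>v x) / (x \<bullet> (P *\<^sub>v x)) \<le> t"
      unfolding t_def using lower[OF _ x False] by (intro cInf_greatest[OF ne])
    then show ?thesis using Ppos[OF x False] by (simp add: divide_le_eq)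
  qed
  define N where "N = t \<cdot>\<^sub>m P - S"
  have Nc: "N \<in> carrier_mat m m" unfolding N_def by (rule minus_carrier_mat) (rule S(1))
  have Nx: "N *\<^sub>v x = t \<cdot>\<^sub>v (P *\<^sub>v x) - S *\<^sub>v x" if "x \<in> carrier_vec m" for x
    unfolding N_def using S Pc that
    by (simp add: minus_mult_distrib_mat_vec[of _ m m] smult_mat_mult_vec[of _ m m])
  have form: "x \<bullet> (N *\<^sub>v x) = t * (x \<bullet> (P *\<^sub>v x)) - x \<bullet> (S *\<^sub>v x)" if "x \<in> carrier_vec m" for x
    unfolding Nx[OF that] using S Pc that by (subst scalar_prod_minus_distrib[of _ m]) auto
  have "(t \<cdot>\<^sub>m P)\<^sup>T = t \<cdot>\<^sub>m P\<^sup>T" by (intro eq_matI) auto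
  then have "N\<^sup>T = N" unfolding N_def using S Pc
    by (simp add: transpose_minus[of _ m m])
  then have N: "psd_mat m N" using Nc form tT by (auto simp: psd_mat_def)
  have "det N = 0"
  proof (rule ccontr)
    assume "det N \<noteq> 0"
    then obtain e where e: "0 < e" "\<And>x. x \<in> carrier_vec m \<Longrightarrow> x \<bullet> x \<le> e * (x \<bullet> (N *\<^sub>v x))"
      by (rule psd_nonsingular_coercive[OF N]) blast
    obtain f where f: "0 < f" "\<And>x. x \<in> carrier_vec m \<Longrightarrow> x \<bullet> (P *\<^sub>v x) \<le> f * (x \<bullet> x)"
      by (rule form_le_const_sq[OF Pc(1)]) blast
    \<comment> \<open>The form of \<open>P\<close> is at most f times x.x, hence at most f e times
      the form of \<open>N\<close>. So \<open>N\<close> dominates \<open>P\<close> divided by f e,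
      and \<open>t\<close> could be lowered by 1 / (f e), contradicting the infimum.\<close>
    have "t - 1 / (f * e) \<in> T"
      unfolding T_def
    proof (intro CollectI ballI)
      fix x :: "real vec" assume x: "x \<in> carrier_vec m"
      have "x \<bullet> (P *\<^sub>v x) \<le> f * (e * (x \<bullet> (N *\<^sub>v x)))"
        by (rule order.trans[OF f(2)[OF x] mult_left_mono]) (use e f x in auto)
      then have "x \<bullet> (P *\<^sub>v x) / (f * e) \<le> x \<bullet> (N *\<^sub>v x)"
        using e f by (simp add: divide_le_eq mult_ac)
      then show "x \<bullet> (S *\<^sub>v x) \<le> (t - 1 / (f * e)) * (x \<bullet> (P *\<^sub>v x))"
        unfolding form[OF x] by (simp add: left_diff_distrib)
    qed
    then have "t \<le> t - 1 / (f * e)" using cInf_lower[OF _ bdd] by (simp add: t_def)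
    then show False using e f by (simp add: field_simps)
  qed
  then obtain v where v: "v \<in> carrier_vec m" "v \<noteq> 0\<^sub>v m" "N *\<^sub>v v = 0\<^sub>v m"
    using det_0_iff_vec_prod_zero_field[OF Nc] by auto
  have "S *\<^sub>v v = t \<cdot>\<^sub>v (P *\<^sub>v v)"
  proof (rule eq_vecI)
    fix i assume "i < dim_vec (t \<cdot>\<^sub>v (P *\<^sub>v v))"
    then have i: "i < m" using Pc by simp
    have "(t \<cdot>\<^sub>v (P *\<^sub>v v) - S *\<^sub>v v) $ i = 0" using v Nx[OF v(1)] i by simp
    then show "(S *\<^sub>v v) $ i = (t \<cdot>\<^sub>v (P *\<^sub>v v)) $ i" using i S Pc by simp
  qed (use S Pc in auto)
  with v tT show thesis by (intro that) auto
qed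

lemma eigenvalue_pencil:
  assumes S: "S \<in> carrier_mat m m" and P: "P \<in> carrier_mat m m" "det P \<noteq> 0"
    and v: "v \<in> carrier_vec m" "v \<noteq> 0\<^sub>v m" "S *\<^sub>v v = t \<cdot>\<^sub>v (P *\<^sub>v v)"
  shows "t \<in> spectrum (minv P * S)"
proof -
  note Pi = minv_props[OF P]
  have "(minv P * S) *\<^sub>v v = minv P *\<^sub>v (t \<cdot>\<^sub>v (P *\<^sub>v v))"
    using Pi S v by (simp add: assoc_mult_mat_vec[of _ m m _ m])
  also have "\<dots> = t \<cdot>\<^sub>v ((minv P * P) *\<^sub>v v)"
    using Pi(1) P v by (simp add: assoc_mult_mat_vec[of _ m m _ m] mult_mat_vec[of _ m m])
  also have "\<dots> = t \<cdot>\<^sub>v v" using Pi v by simp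
  finally show ?thesis
    unfolding spectrum_def eigenvalue_def eigenvector_def using v Pi by auto
qed

text \<open>The \<open>t\<close> of \<open>max_eigenvalue_pencil\<close> bounds the quotient and is
  itself an eigenvalue, so it is at most the maximum of the finite spectrum.\<close>

lemma form_le_Max_spectrum:
  assumes S: "S \<in> carrier_mat m m" "S\<^sup>T = S" and P: "spd_mat m P" and x: "x \<in> carrier_vec m"
  shows "x \<bullet> (S *\<^sub>v x) \<le> Max (spectrum (minv P * S)) * (x \<bullet> (P *\<^sub>v x))"
proof (cases "m = 0")
  \<comment> \<open>In dimension zero the spectrum is empty and \<open>Max\<close> has no known
    value, but both forms vanish.\<close>
  case True then show ?thesis using x S P by (simp add: scalar_prod_def spd_mat_def)
next
  case False
  have Pc: "P \<in> carrier_mat m m" using P by (simp add: spd_mat_def)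
  note Pi = minv_props[OF Pc spd_det_nonzero[OF P]]
  have fin: "finite (spectrum (minv P * S))" by (rule card_finite_spectrum[of _ m]) (use Pi S in simp)
  from False obtain t v where v: "v \<in> carrier_vec m" "v \<noteq> 0\<^sub>v m" "S *\<^sub>v v = t \<cdot>\<^sub>v (P *\<^sub>v v)"
    and t: "\<And>x. x \<in> carrier_vec m \<Longrightarrow> x \<bullet> (S *\<^sub>v x) \<le> t * (x \<bullet> (P *\<^sub>v x))"
    by (metis max_eigenvalue_pencil[OF S P] gr0I)
  have "t \<le> Max (spectrum (minv P * S))"
    using eigenvalue_pencil[OF S(1) Pc spd_det_nonzero[OF P] v] fin by simp
  moreover have "0 \<le> x \<bullet> (P *\<^sub>v x)" using spd_imp_psd[OF P] x by (simp add: psd_mat_def)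
  ultimately show ?thesis using t[OF x] mult_right_mono by (metis order.trans)
qed

text \<open>Applying \<open>max_eigenvalue_pencil\<close> to \<open>- S\<close> turns the upper
  bound into a lower one, with eigenvalue \<open>- t\<close> for \<open>S\<close>.\<close>

lemma form_ge_Min_spectrum:
  assumes S: "S \<in> carrier_mat m m" "S\<^sup>T = S" and P: "spd_mat m P" and x: "x \<in> carrier_vec m"
  shows "Min (spectrum (minv P * S)) * (x \<bullet> (P *\<^sub>v x)) \<le> x \<bullet> (S *\<^sub>v x)"
proof (cases "m = 0")
  case True then show ?thesis using x S P by (simp add: scalar_prod_def spd_mat_def)
next
  case False
  have Pc: "P \<in> carrier_mat m m" using P by (simp add: spd_mat_def)
  note Pi = minv_props[OF Pc spd_det_nonzero[OF P]]
  have fin: "finite (spectrum (minv P * S))" by (rule card_finite_spectrum[of _ m]) (use Pi S in simp)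
  have S': "- S \<in> carrier_mat m m" "(- S)\<^sup>T = - S" using S by (auto simp: transpose_uminus)
  from False obtain t v where v: "v \<in> carrier_vec m" "v \<noteq> 0\<^sub>v m" "- S *\<^sub>v v = t \<cdot>\<^sub>v (P *\<^sub>v v)"
    and t: "\<And>x. x \<in> carrier_vec m \<Longrightarrow> x \<bullet> (- S *\<^sub>v x) \<le> t * (x \<bullet> (P *\<^sub>v x))"
    by (metis max_eigenvalue_pencil[OF S' P] gr0I)
  have neg: "- S *\<^sub>v x = - (S *\<^sub>v x)" if "x \<in> carrier_vec m" for x
    using S(1) that by auto
  have "S *\<^sub>v v = - (t \<cdot>\<^sub>v (P *\<^sub>v v))" using v(3) neg[OF v(1)] by (metis uminus_uminus_vec)
  also have "\<dots> = (- t) \<cdot>\<^sub>v (P *\<^sub>v v)" by auto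
  finally have "Min (spectrum (minv P * S)) \<le> - t"
    using eigenvalue_pencil[OF S(1) Pc spd_det_nonzero[OF P] v(1,2)] fin by simp
  moreover have "0 \<le> x \<bullet> (P *\<^sub>v x)" using spd_imp_psd[OF P] x by (simp add: psd_mat_def)
  moreover have "- t * (x \<bullet> (P *\<^sub>v x)) \<le> x \<bullet> (S *\<^sub>v x)"
    using t[OF x] neg[OF x] S(1) x by (simp add: scalar_prod_uminus_right)
  ultimately show ?thesis using mult_right_mono by (metis order.trans)
qed

lemma spectrum_Max_nonneg:
  assumes S: "psd_mat m S" and P: "spd_mat m P" and m: "0 < m"
  shows "0 \<le> Max (spectrum (minv P * S))"
proof -
  define u :: "real vec" where "u = unit_vec m 0"
  have u: "u \<in> carrier_vec m" "u \<noteq> 0\<^sub>v m" using m by (auto simp: u_def)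
  have "0 \<le> Max (spectrum (minv P * S)) * (u \<bullet> (P *\<^sub>v u))"
    using form_le_Max_spectrum[OF _ _ P u(1), of S] S u by (force simp: psd_mat_def)
  moreover have "0 < u \<bullet> (P *\<^sub>v u)" using P u by (simp add: spd_mat_def)
  ultimately show ?thesis by (simp add: zero_le_mult_iff)
qed

section \<open>Reality of the eigenvalues of a definite pencil\<close>

lemma map_vec_mult_real_mat:
  assumes M: "M \<in> carrier_mat k n" and u: "u \<in> carrier_vec n"
  shows "map_vec Re (map_mat complex_of_real M *\<^sub>v u) = M *\<^sub>v map_vec Re u"
    "map_vec Im (map_mat complex_of_real M *\<^sub>v u) = M *\<^sub>v map_vec Im u"
  using assms by (auto intro!: eq_vecI simp: scalar_prod_def)

text \<open>For \<open>H u = z W u\<close>, pairing the real part of the equation with \<open>Im u\<close> and the imaginary part with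
  \<open>Re u\<close> makes the symmetric terms cancel and leaves \<open>Im z\<close> times a positive number.\<close>

lemma pencil_root_real:
  assumes H: "H \<in> carrier_mat n n" "H\<^sup>T = H" and W: "spd_mat n W"
    and G: "G \<in> carrier_mat n n" and WG: "W * G = H"
    and z: "poly (char_poly (map_mat complex_of_real G)) z = 0"
  obtains r v where "z = complex_of_real r" "v \<in> carrier_vec n" "v \<noteq> 0\<^sub>v n" "H *\<^sub>v v = r \<cdot>\<^sub>v (W *\<^sub>v v)"
proof -
  let ?c = "map_mat complex_of_real"
  have Wc: "W \<in> carrier_mat n n" "W\<^sup>T = W" using W by (auto simp: spd_mat_def)
  have cG: "?c G \<in> carrier_mat n n" "?c W \<in> carrier_mat n n" using G Wc by auto
  obtain u where u: "u \<in> carrier_vec n" "u \<noteq> 0\<^sub>v n" and Gu: "?c G *\<^sub>v u = z \<cdot>\<^sub>v u"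
    using z eigenvalue_root_char_poly[OF cG(1)] G by (auto simp: eigenvalue_def eigenvector_def)
  have Hu: "?c H *\<^sub>v u = z \<cdot>\<^sub>v (?c W *\<^sub>v u)"
    unfolding WG[symmetric] of_real_hom.mat_hom_mult[OF Wc(1) G]
    using cG u Gu by (simp add: assoc_mult_mat_vec[of _ n n _ n] mult_mat_vec[of _ n n])
  define a b where "a = map_vec Re u" and "b = map_vec Im u"
  define \<alpha> \<beta> where "\<alpha> = Re z" and "\<beta> = Im z"
  have ab: "a \<in> carrier_vec n" "b \<in> carrier_vec n" using u by (auto simp: a_def b_def)
  have Wab: "W *\<^sub>v a \<in> carrier_vec n" "W *\<^sub>v b \<in> carrier_vec n" using Wc ab by auto
  have Wu: "map_vec Re (?c W *\<^sub>v u) = W *\<^sub>v a" "map_vec Im (?c W *\<^sub>v u) = W *\<^sub>v b"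
    using map_vec_mult_real_mat[OF Wc(1) u(1)] by (auto simp: a_def b_def)
  have Wui: "Re ((?c W *\<^sub>v u) $ i) = (W *\<^sub>v a) $ i" "Im ((?c W *\<^sub>v u) $ i) = (W *\<^sub>v b) $ i" if "i < n" for i
    using that Wc arg_cong[OF Wu(1), of "\<lambda>v. vec_index v i"] arg_cong[OF Wu(2), of "\<lambda>v. vec_index v i"] by auto
  have Ha: "H *\<^sub>v a = \<alpha> \<cdot>\<^sub>v (W *\<^sub>v a) + (- \<beta>) \<cdot>\<^sub>v (W *\<^sub>v b)"
  proof -
    have "H *\<^sub>v a = map_vec Re (z \<cdot>\<^sub>v (?c W *\<^sub>v u))"
      using map_vec_mult_real_mat(1)[OF H(1) u(1)] Hu by (simp add: a_def)
    also have "\<dots> = \<alpha> \<cdot>\<^sub>v (W *\<^sub>v a) + (- \<beta>) \<cdot>\<^sub>v (W *\<^sub>v b)"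
      using Wc Wui by (intro eq_vecI) (auto simp: \<alpha>_def \<beta>_def simp del: index_mult_mat_vec)
    finally show ?thesis .
  qed
  have Hb: "H *\<^sub>v b = \<alpha> \<cdot>\<^sub>v (W *\<^sub>v b) + \<beta> \<cdot>\<^sub>v (W *\<^sub>v a)"
  proof -
    have "H *\<^sub>v b = map_vec Im (z \<cdot>\<^sub>v (?c W *\<^sub>v u))"
      using map_vec_mult_real_mat(2)[OF H(1) u(1)] Hu by (simp add: b_def)
    also have "\<dots> = \<alpha> \<cdot>\<^sub>v (W *\<^sub>v b) + \<beta> \<cdot>\<^sub>v (W *\<^sub>v a)"
      using Wc Wui by (intro eq_vecI) (auto simp: \<alpha>_def \<beta>_def simp del: index_mult_mat_vec)
    finally show ?thesis .
  qed
  have nz: "a \<noteq> 0\<^sub>v n \<or> b \<noteq> 0\<^sub>v n"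
  proof (rule ccontr)
    assume "\<not> ?thesis"
    then have "a $ i = 0" "b $ i = 0" if "i < n" for i using that by auto
    then have "u = 0\<^sub>v n"
      using u(1) by (intro eq_vecI) (auto simp: a_def b_def complex_eq_iff)
    with u(2) show False by simp
  qed
  have "\<beta> * (a \<bullet> (W *\<^sub>v a) + b \<bullet> (W *\<^sub>v b)) = 0"
    using symmetric_form_commute[OF H ab] symmetric_form_commute[OF Wc ab] ab Wab
    by (simp add: Ha Hb scalar_prod_add_distrib[of _ n] algebra_simps)
  moreover have "0 < a \<bullet> (W *\<^sub>v a) + b \<bullet> (W *\<^sub>v b)"
  proof -
    have "0 \<le> a \<bullet> (W *\<^sub>v a)" "0 \<le> b \<bullet> (W *\<^sub>v b)"
      using spd_imp_psd[OF W] ab by (auto simp: psd_mat_def)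
    moreover have "0 < a \<bullet> (W *\<^sub>v a) \<or> 0 < b \<bullet> (W *\<^sub>v b)"
      using W ab nz by (auto simp: spd_mat_def)
    ultimately show ?thesis by linarith
  qed
  ultimately have \<beta>: "\<beta> = 0" by simp
  have z: "z = complex_of_real \<alpha>" using \<beta> by (simp add: \<alpha>_def \<beta>_def complex_eq_iff)
  \<comment> \<open>Once \<open>z\<close> is real, the real and imaginary parts of \<open>u\<close>
    solve the same real equation; whichever is nonzero serves as the real eigenvector.\<close>
  have "H *\<^sub>v a = \<alpha> \<cdot>\<^sub>v (W *\<^sub>v a)" "H *\<^sub>v b = \<alpha> \<cdot>\<^sub>v (W *\<^sub>v b)"
    using Ha Hb \<beta> Wab by (auto intro!: eq_vecI simp del: index_mult_mat_vec)
  with nz z ab show thesis using that by metis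
qed

section \<open>The scalar inequality for an eigenvalue\<close>

text \<open>Completing the square gives (2l - L)^2 <= L^2 - 4c. The hypothesis thus forces the
  discriminant to be nonnegative, so \<open>sqrt\<close> is applied in its proper range.\<close>

lemma quadratic_nonpos_bounds:
  fixes l L c :: real
  assumes "l\<^sup>2 - L * l + c \<le> 0"
  shows "(L - sqrt (L\<^sup>2 - 4 * c)) / 2 \<le> l" "l \<le> (L + sqrt (L\<^sup>2 - 4 * c)) / 2"
proof -
  have "(2 * l - L)\<^sup>2 \<le> L\<^sup>2 - 4 * c" using assms by (simp add: power2_eq_square algebra_simps)
  then have "\<bar>2 * l - L\<bar> \<le> sqrt (L\<^sup>2 - 4 * c)"
    using real_sqrt_le_mono by fastforce
  then show "(L - sqrt (L\<^sup>2 - 4 * c)) / 2 \<le> l" "l \<le> (L + sqrt (L\<^sup>2 - 4 * c)) / 2" by auto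
qed

text \<open>Here \<open>a\<close>, \<open>b\<close>, \<open>s\<close>, \<open>k\<close>, \<open>e\<close> stand for the values \<open>x\<^sup>TPx\<close>, \<open>y\<^sup>TDy\<close>, \<open>x\<^sup>TBA\<^sup>-\<^sup>1B\<^sup>Tx\<close>, \<open>y\<^sup>TCA\<^sup>-\<^sup>1C\<^sup>Ty\<close>,
  \<open>x\<^sup>TBA\<^sup>-\<^sup>1C\<^sup>Ty\<close> at an eigenvector \<open>(x, y)\<close>.
  With \<open>f \<mu> = l\<^sup>2 - \<theta> (1 + \<nu>) l + \<tau> \<mu> (\<theta> - l)\<close>, one has \<open>f (s / a) \<le> 0\<close> if \<open>a \<noteq> 0\<close>; this is monotone in \<open>\<mu>\<close>,
  increasing or decreasing according to the sign of \<open>\<theta> - l\<close>, and \<open>l = \<theta>\<close> itself always satisfies \<open>f \<mu> \<le> 0\<close>.\<close>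

lemma compressed_eigenvalue_bounds:
  fixes a b s k e l \<tau> \<theta> \<mu>\<^sub>1 \<mu>\<^sub>2 \<nu> :: real
  assumes pos: "0 < \<tau>" "0 < \<theta>" and ab: "0 \<le> a" "0 \<le> b" "0 < a \<or> 0 < b"
    and eq1: "\<tau> * (s + e) = l * a" and eq2: "\<theta> * (e + k + b) = l * b"
    and cs: "e\<^sup>2 \<le> s * k" and psd: "0 \<le> s + 2 * e + k"
    and s: "0 \<le> s" "\<mu>\<^sub>1 * a \<le> s" "s \<le> \<mu>\<^sub>2 * a" and k: "0 \<le> k" "k \<le> \<nu> * b"
    and \<mu>\<^sub>2: "0 \<le> \<mu>\<^sub>2" and \<nu>: "0 \<le> \<nu>"
  defines "L\<^sub>1 \<equiv> \<theta> * (1 + \<nu>) + \<tau> * \<mu>\<^sub>1" and "L\<^sub>2 \<equiv> \<theta> * (1 + \<nu>) + \<tau> * \<mu>\<^sub>2"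
  shows "(L\<^sub>1 - sqrt (L\<^sub>1\<^sup>2 - 4 * \<tau> * \<theta> * \<mu>\<^sub>1)) / 2 \<le> l"
    and "l \<le> (L\<^sub>2 + sqrt (L\<^sub>2\<^sup>2 - 4 * \<tau> * \<theta> * \<mu>\<^sub>2)) / 2"
proof -
  define f where "f \<mu> t = t\<^sup>2 - \<theta> * (1 + \<nu>) * t + \<tau> * \<mu> * (\<theta> - t)" for \<mu> t
  have bound1: "(L\<^sub>1 - sqrt (L\<^sub>1\<^sup>2 - 4 * \<tau> * \<theta> * \<mu>\<^sub>1)) / 2 \<le> t" if "f \<mu>\<^sub>1 t \<le> 0" for t
    using quadratic_nonpos_bounds(1)[of t L\<^sub>1 "\<tau> * \<theta> * \<mu>\<^sub>1"] that
    by (simp add: f_def L\<^sub>1_def algebra_simps)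
  have bound2: "t \<le> (L\<^sub>2 + sqrt (L\<^sub>2\<^sup>2 - 4 * \<tau> * \<theta> * \<mu>\<^sub>2)) / 2" if "f \<mu>\<^sub>2 t \<le> 0" for t
    using quadratic_nonpos_bounds(2)[of t L\<^sub>2 "\<tau> * \<theta> * \<mu>\<^sub>2"] that
    by (simp add: f_def L\<^sub>2_def algebra_simps)
  \<comment> \<open>The value is -theta^2 nu, so theta lies between the two roots for every mu.
    Hence the lower bound only has to be proved for l < theta, and the upper one for l >
    theta.\<close>
  have f\<theta>: "f \<mu> \<theta> \<le> 0" for \<mu> using \<nu> by (simp add: f_def power2_eq_square algebra_simps)
  have l0: "0 \<le> l"
  proof -
    \<comment> \<open>This is v.Hv = l v.Wv multiplied by tau theta; nonnegativity of
      \<open>l\<close> is needed below to replace k by nu b.\<close>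
    have "l * (\<theta> * a + \<tau> * b) = \<tau> * \<theta> * ((s + 2 * e + k) + b)"
      using arg_cong[OF eq1, of "(*) \<theta>"] arg_cong[OF eq2, of "(*) \<tau>"] by (simp add: algebra_simps)
    also have "\<dots> \<ge> 0" using pos psd ab by simp
    finally have "0 \<le> l * (\<theta> * a + \<tau> * b)" .
    moreover have "0 < \<theta> * a + \<tau> * b"
      using pos ab by (auto intro: add_pos_nonneg add_nonneg_pos)
    ultimately show ?thesis by (simp add: zero_le_mult_iff)
  qed
  \<comment> \<open>This is f (s / a) <= 0 multiplied by \<open>a\<close>, which stays meaningful
    for a = 0.\<close>
  have key: "(l\<^sup>2 - \<theta> * (1 + \<nu>) * l) * a + \<tau> * s * (\<theta> - l) \<le> 0"
  proof (cases "0 < b")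
    case True
    have "\<tau> * e = l * a - \<tau> * s" "\<theta> * e = l * b - \<theta> * (k + b)"
      using eq1 eq2 by (simp_all add: algebra_simps)
    \<comment> \<open>Each equation is solved for \<open>e\<close> and the results are multiplied.
      After Cauchy-Schwarz the terms with s k cancel, the remaining k is bounded by nu b, and a
      common factor \<open>b\<close> is left.\<close>
    then have "(\<tau> * \<theta>) * e\<^sup>2 = (l * a - \<tau> * s) * (l * b - \<theta> * (k + b))"
      by (metis mult.assoc mult.left_commute power2_eq_square)
    moreover have "(\<tau> * \<theta>) * e\<^sup>2 \<le> (\<tau> * \<theta>) * (s * k)" using cs pos by (intro mult_left_mono) auto
    moreover have "l * a * \<theta> * k \<le> l * a * \<theta> * (\<nu> * b)" using k l0 ab pos by (intro mult_left_mono) auto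
    ultimately have "b * ((l\<^sup>2 - \<theta> * (1 + \<nu>) * l) * a + \<tau> * s * (\<theta> - l)) \<le> 0"
      by (simp add: power2_eq_square algebra_simps)
    with True show ?thesis by (simp add: mult_le_0_iff)
  next
    case False
    \<comment> \<open>From b = 0 follows k = 0, and then Cauchy-Schwarz forces e = 0, leaving a
      scalar equation in \<open>a\<close> and \<open>s\<close> alone.\<close>
    then have "b = 0" "k = 0" "e = 0" using ab k cs by auto
    then have la: "l * a = \<tau> * s" using eq1 by simp
    have "(l\<^sup>2 - \<theta> * (1 + \<nu>) * l) * a + \<tau> * s * (\<theta> - l) = l * (l * a) - \<theta> * (1 + \<nu>) * (l * a) + \<tau> * s * (\<theta> - l)"
      by (simp add: power2_eq_square algebra_simps)
    also have "\<dots> = - (\<theta> * \<nu> * \<tau> * s)" unfolding la by (simp add: algebra_simps)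
    also have "\<dots> \<le> 0" using pos \<nu> s by simp
    finally show ?thesis .
  qed
  \<comment> \<open>The case of an eigenvector supported on the \<open>C\<close> block, where the
    quotient s / a does not exist: l is theta (1 + k / b). It cannot occur for l < theta, and for l
    > theta the upper bound treats it separately.\<close>
  have a0: "\<theta> \<le> l \<and> l \<le> \<theta> * (1 + \<nu>)" if "a = 0"
  proof -
    have "s = 0" "e = 0" "0 < b" using that s ab cs by auto
    then have "l = \<theta> * (1 + k / b)" using eq2 by (simp add: field_simps)
    moreover have "0 \<le> k / b" "k / b \<le> \<nu>" using k \<open>0 < b\<close> by (auto simp: divide_le_eq)
    ultimately show ?thesis using pos by simp
  qed
  show "(L\<^sub>1 - sqrt (L\<^sub>1\<^sup>2 - 4 * \<tau> * \<theta> * \<mu>\<^sub>1)) / 2 \<le> l"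
  proof (cases "\<theta> \<le> l")
    case True
    with bound1[OF f\<theta>] show ?thesis by simp
  next
    case False
    then have a: "0 < a" using a0 ab by force
    have "\<tau> * (\<theta> - l) * (\<mu>\<^sub>1 * a) \<le> \<tau> * (\<theta> - l) * s"
      using False pos s by (intro mult_left_mono) auto
    with key have "a * f \<mu>\<^sub>1 l \<le> 0" by (simp add: f_def algebra_simps)
    with a show ?thesis by (intro bound1) (simp add: mult_le_0_iff)
  qed
  show "l \<le> (L\<^sub>2 + sqrt (L\<^sub>2\<^sup>2 - 4 * \<tau> * \<theta> * \<mu>\<^sub>2)) / 2"
  proof (cases "l \<le> \<theta>")
    case True
    with bound2[OF f\<theta>] show ?thesis by simp
  next
    case l: False
    show ?thesis
    proof (cases "a = 0")
      case True
      \<comment> \<open>With a = 0 the inequality \<open>key\<close> is void; instead the two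
        summands of \<open>f\<close> at the upper mu are nonpositive separately.\<close>
      have "l * (l - \<theta> * (1 + \<nu>)) \<le> 0" using a0[OF True] l0 by (simp add: mult_le_0_iff)
      moreover have "\<tau> * \<mu>\<^sub>2 * (\<theta> - l) \<le> 0" using l pos \<mu>\<^sub>2 by (simp add: mult_le_0_iff)
      ultimately show ?thesis by (intro bound2) (simp add: f_def power2_eq_square algebra_simps)
    next
      case False
      have "\<tau> * (l - \<theta>) * s \<le> \<tau> * (l - \<theta>) * (\<mu>\<^sub>2 * a)"
        using l pos s by (intro mult_left_mono) auto
      with key have "a * f \<mu>\<^sub>2 l \<le> 0" by (simp add: f_def algebra_simps)
      with False ab show ?thesis by (intro bound2) (simp add: mult_le_0_iff)
    qed
  qed
qed

section \<open>Splitting off the eigenvalue one with its multiplicity\<close>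

lemma char_poly_four_block_lower_left_zero:
  fixes A1 :: "'a :: idom mat"
  assumes A1: "A1 \<in> carrier_mat n n" and A2: "A2 \<in> carrier_mat n k" and A3: "A3 \<in> carrier_mat k k"
  shows "char_poly (four_block_mat A1 A2 (0\<^sub>m k n) A3) = char_poly A1 * char_poly A3"
proof -
  let ?cm = "\<lambda> A. [:0, 1:] \<cdot>\<^sub>m 1\<^sub>m (dim_row A) + map_mat (\<lambda>a. [:- a:]) A"
  let ?B2 = "map_mat (\<lambda>a. [:- a:]) A2"
  have "?cm (four_block_mat A1 A2 (0\<^sub>m k n) A3) = four_block_mat (?cm A1) ?B2 (0\<^sub>m k n) (?cm A3)"
    by (rule eq_matI, insert A1 A2 A3, auto simp: one_poly_def)
  then show ?thesis
    unfolding char_poly_defs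
    by (simp, subst det_four_block_mat_lower_left_zero[OF _ _ refl], insert A1 A2 A3, auto)
qed

lemma char_poly_one_mat: "char_poly (1\<^sub>m n :: 'a :: idom mat) = [:- 1, 1:] ^ n"
proof -
  have "char_poly (1\<^sub>m n :: 'a mat) = (\<Prod> a \<leftarrow> diag_mat (1\<^sub>m n :: 'a mat). [:- a, 1:])"
    by (rule char_poly_upper_triangular[of _ n]) auto
  also have "diag_mat (1\<^sub>m n :: 'a mat) = replicate n 1"
    by (rule nth_equalityI) (auto simp: diag_mat_def)
  finally show ?thesis by simp
qed

lemma eigvals_mset_block_one:
  assumes X: "X \<in> carrier_mat n k" and G: "G \<in> carrier_mat k k"
  shows "eigvals_mset (four_block_mat (1\<^sub>m n) X (0\<^sub>m k n) G) = replicate_mset n 1 + eigvals_mset G"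
proof -
  let ?c = "map_mat complex_of_real"
  have "?c (four_block_mat (1\<^sub>m n) X (0\<^sub>m k n) G) = four_block_mat (1\<^sub>m n) (?c X) (0\<^sub>m k n) (?c G)"
    using X G by (intro eq_matI) auto
  then have "char_poly (?c (four_block_mat (1\<^sub>m n) X (0\<^sub>m k n) G)) = [:- 1, 1:] ^ n * char_poly (?c G)"
    using X G by (simp add: char_poly_four_block_lower_left_zero[of _ n _ k] char_poly_one_mat)
  \<comment> \<open>\<open>proots\<close> turns products into sums only for nonzero polynomials; a
    characteristic polynomial is monic.\<close>
  moreover have "char_poly (?c G) \<noteq> 0"
    using degree_monic_char_poly[of "?c G" k] G by fastforce
  ultimately show ?thesis
    by (simp add: eigvals_mset_def proots_mult proots_power)
qed

lemma size_eigvals_mset: "G \<in> carrier_mat k k \<Longrightarrow> size (eigvals_mset G) = k"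
  using degree_monic_char_poly[of "map_mat complex_of_real G" k]
  by (simp add: eigvals_mset_def size_proots_complex)

lemma minv_mult_eqI:
  assumes A: "(A :: 'a :: field mat) \<in> carrier_mat n n" "det A \<noteq> 0"
    and M: "M \<in> carrier_mat n k" and eq: "A * M = Y"
  shows "minv A * Y = M"
  using minv_props[OF A] A M unfolding eq[symmetric]
  by (simp flip: assoc_mult_mat[of _ n n _ n _ k])

section \<open>Forms of block matrices and the block factorisation\<close>

lemma spd_append:
  assumes P: "spd_mat m P" and D: "spd_mat p D" and \<alpha>: "0 < \<alpha>" and \<beta>: "0 < \<beta>"
  shows "spd_mat (m + p) (four_block_mat (\<alpha> \<cdot>\<^sub>m P) (0\<^sub>m m p) (0\<^sub>m p m) (\<beta> \<cdot>\<^sub>m D))"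
    (is "spd_mat _ ?W")
proof -
  have c: "P \<in> carrier_mat m m" "D \<in> carrier_mat p p" "P\<^sup>T = P" "D\<^sup>T = D"
    using P D by (auto simp: spd_mat_def)
  have tr: "(\<alpha> \<cdot>\<^sub>m P)\<^sup>T = \<alpha> \<cdot>\<^sub>m P\<^sup>T" "(\<beta> \<cdot>\<^sub>m D)\<^sup>T = \<beta> \<cdot>\<^sub>m D\<^sup>T"
    by (auto intro!: eq_matI)
  have "0 < v \<bullet> (?W *\<^sub>v v)" if v: "v \<in> carrier_vec (m + p)" "v \<noteq> 0\<^sub>v (m + p)" for v
  proof -
    define x y where "x = vec_first v m" and "y = vec_last v p"
    have xy: "x \<in> carrier_vec m" "y \<in> carrier_vec p" "v = x @\<^sub>v y"
      using v by (auto simp: x_def y_def)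
    have "v \<bullet> (?W *\<^sub>v v) = \<alpha> * (x \<bullet> (P *\<^sub>v x)) + \<beta> * (y \<bullet> (D *\<^sub>v y))"
      using c xy by (simp add: mult_mat_vec_split[of _ m _ p] scalar_prod_append[of _ m _ p]
          smult_mat_mult_vec[of _ m m] smult_mat_mult_vec[of _ p p])
    moreover have "x \<noteq> 0\<^sub>v m \<or> y \<noteq> 0\<^sub>v p"
      using v xy by auto
    moreover have "0 \<le> x \<bullet> (P *\<^sub>v x)" "0 \<le> y \<bullet> (D *\<^sub>v y)"
      "x \<noteq> 0\<^sub>v m \<Longrightarrow> 0 < x \<bullet> (P *\<^sub>v x)" "y \<noteq> 0\<^sub>v p \<Longrightarrow> 0 < y \<bullet> (D *\<^sub>v y)"
      using spd_imp_psd[OF P] spd_imp_psd[OF D] P D xy by (auto simp: psd_mat_def spd_mat_def)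
    ultimately show ?thesis using \<alpha> \<beta>
      by (metis add_nonneg_pos add_pos_nonneg mult_nonneg_nonneg mult_pos_pos less_imp_le)
  qed
  then show ?thesis
    using c tr by (auto simp: spd_mat_def transpose_four_block_mat[of _ m m _ p _ p])
qed

text \<open>Used with N the inverse of \<open>A\<close> and with \<open>B\<close>, \<open>C\<close>
  and the stacked matrix \<open>F\<close> in turn. The second part is stated for two vectors because
  the cross term between the blocks is needed too.\<close>

lemma psd_congruence:
  assumes N: "psd_mat n N" and B: "B \<in> carrier_mat m n"
  shows "psd_mat m (B * N * B\<^sup>T)"
    and "\<And>x y. x \<in> carrier_vec m \<Longrightarrow> y \<in> carrier_vec m \<Longrightarrow>
      x \<bullet> ((B * N * B\<^sup>T) *\<^sub>v y) = (B\<^sup>T *\<^sub>v x) \<bullet> (N *\<^sub>v (B\<^sup>T *\<^sub>v y))"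
proof -
  have Nc: "N \<in> carrier_mat n n" "N\<^sup>T = N" using N by (auto simp: psd_mat_def)
  show form: "x \<bullet> ((B * N * B\<^sup>T) *\<^sub>v y) = (B\<^sup>T *\<^sub>v x) \<bullet> (N *\<^sub>v (B\<^sup>T *\<^sub>v y))"
    if "x \<in> carrier_vec m" "y \<in> carrier_vec m" for x y
  proof -
    have "(B * N * B\<^sup>T) *\<^sub>v y = B *\<^sub>v (N *\<^sub>v (B\<^sup>T *\<^sub>v y))"
      using Nc B that by (simp add: assoc_mult_mat_vec[of _ m n _ m] assoc_mult_mat_vec[of _ m n _ n])
    then show ?thesis using scalar_mult_transpose[OF B that(1), of "N *\<^sub>v (B\<^sup>T *\<^sub>v y)"] Nc B that by simp
  qed
  have "(B * N * B\<^sup>T)\<^sup>T = B * N * B\<^sup>T"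
    using Nc B by (simp add: transpose_mult[of _ m n _ m] transpose_mult[of _ n n _ m] assoc_mult_mat[of _ m n _ n _ m])
  then show "psd_mat m (B * N * B\<^sup>T)"
    using form N B Nc by (auto simp: psd_mat_def)
qed

text \<open>For w = \<open>minv A\<close> x the form of the inverse at \<open>x\<close> is the form
  of \<open>A\<close> at \<open>w\<close>.\<close>

lemma psd_minv:
  assumes A: "spd_mat n A"
  shows "psd_mat n (minv A)"
proof -
  have Ac: "A \<in> carrier_mat n n" "A\<^sup>T = A" using A by (auto simp: spd_mat_def)
  note Ai = minv_props[OF Ac(1) spd_det_nonzero[OF A]]
  have "(minv A)\<^sup>T = (minv A)\<^sup>T * (A * minv A)" using Ai by simp
  also have "\<dots> = ((minv A)\<^sup>T * A\<^sup>T) * minv A"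
    using Ai(1) Ac by (simp add: assoc_mult_mat[of _ n n _ n _ n])
  also have "(minv A)\<^sup>T * A\<^sup>T = 1\<^sub>m n"
    using Ai Ac by (metis transpose_mult transpose_one)
  finally have sym: "(minv A)\<^sup>T = minv A" using Ai by simp
  have "0 \<le> x \<bullet> (minv A *\<^sub>v x)" if x: "x \<in> carrier_vec n" for x
  proof -
    define w where "w = minv A *\<^sub>v x"
    have w: "w \<in> carrier_vec n" "A *\<^sub>v w = x"
      using Ai x Ac unfolding w_def by (auto simp flip: assoc_mult_mat_vec[of _ n n _ n])
    have "x \<bullet> (minv A *\<^sub>v x) = w \<bullet> (A *\<^sub>v w)"
      using comm_scalar_prod[OF x w(1)] w(2) by (simp add: w_def)
    then show ?thesis using spd_imp_psd[OF A] w(1) by (metis psd_mat_def)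
  qed
  with sym Ai show ?thesis by (auto simp: psd_mat_def)
qed

text \<open>The inverse of the block triangular matrix is never written out: multiplying the claimed
  result by that matrix must give the saddle matrix, and the only nontrivial block is F A^-1 K - W G
  = Z.\<close>

lemma minv_block_triangular_mult_saddle:
  fixes A F W Z G :: "'a :: field mat"
  assumes A: "A \<in> carrier_mat n n" "det A \<noteq> 0" and F: "F \<in> carrier_mat k n" and K: "K \<in> carrier_mat n k"
    and W: "W \<in> carrier_mat k k" "det W \<noteq> 0" and Z: "Z \<in> carrier_mat k k" and G: "G \<in> carrier_mat k k"
    and WG: "W * G = F * minv A * K - Z"
  shows "minv (four_block_mat A (0\<^sub>m n k) F (- W)) * four_block_mat A K F Z
    = four_block_mat (1\<^sub>m n) (minv A * K) (0\<^sub>m k n) G"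
proof (rule minv_mult_eqI)
  note Ai = minv_props[OF A]
  show "four_block_mat A (0\<^sub>m n k) F (- W) \<in> carrier_mat (n + k) (n + k)" using A W by simp
  have "det (- W) \<noteq> 0" using W det_0_negate[OF W(1)] by simp
  then show "det (four_block_mat A (0\<^sub>m n k) F (- W)) \<noteq> 0"
    using A F W by (simp add: det_four_block_mat_upper_right_zero[of _ n _ k])
  show "four_block_mat (1\<^sub>m n) (minv A * K) (0\<^sub>m k n) G \<in> carrier_mat (n + k) (n + k)" using G by simp
  have 1: "A * (minv A * K) = K"
    using Ai A K by (simp flip: assoc_mult_mat[of _ n n _ n _ k])
  have 2: "F * (minv A * K) = F * minv A * K"
    using Ai A K F by (simp add: assoc_mult_mat[of _ k n _ n _ k])
  have FK: "F * minv A * K \<in> carrier_mat k k" using F K Ai(1) by simp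
  have "- W * G = - (W * G)" using W G by simp
  then have 3: "F * minv A * K + - W * G = Z"
    unfolding WG using FK Z by (intro eq_matI) auto
  show "four_block_mat A (0\<^sub>m n k) F (- W) * four_block_mat (1\<^sub>m n) (minv A * K) (0\<^sub>m k n) G
    = four_block_mat A K F Z"
  proof (subst mult_four_block_mat)
    show "A \<in> carrier_mat n n" "0\<^sub>m n k \<in> carrier_mat n k" "F \<in> carrier_mat k n" "- W \<in> carrier_mat k k"
      "1\<^sub>m n \<in> carrier_mat n n" "minv A * K \<in> carrier_mat n k" "0\<^sub>m k n \<in> carrier_mat k n"
      "G \<in> carrier_mat k k"
      using A F W K G Ai(1) by auto
    have "A * 1\<^sub>m n + 0\<^sub>m n k * 0\<^sub>m k n = A" "A * (minv A * K) + 0\<^sub>m n k * G = K"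
      "F * 1\<^sub>m n + - W * 0\<^sub>m k n = F" "F * (minv A * K) + - W * G = Z"
      unfolding 1 2 3 using A F W K G by auto
    then show "four_block_mat (A * 1\<^sub>m n + 0\<^sub>m n k * 0\<^sub>m k n) (A * (minv A * K) + 0\<^sub>m n k * G)
        (F * 1\<^sub>m n + - W * 0\<^sub>m k n) (F * (minv A * K) + - W * G) = four_block_mat A K F Z"
      by (rule cong_four_block_mat)
  qed
qed

lemma transpose_append_rows:
  assumes "B \<in> carrier_mat m n" "C \<in> carrier_mat p n"
  shows "(B @\<^sub>r C)\<^sup>T = B\<^sup>T @\<^sub>c C\<^sup>T"
  unfolding append_rows_def append_cols_def using assms
  by (subst transpose_four_block_mat[of _ m n _ 0 _ p]) (auto intro: cong_four_block_mat)

lemma append_cols_mult_vec: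
  fixes X Y :: "'a :: semiring_0 mat"
  assumes "X \<in> carrier_mat n m" "Y \<in> carrier_mat n p" "x \<in> carrier_vec m" "y \<in> carrier_vec p"
  shows "(X @\<^sub>c Y) *\<^sub>v (x @\<^sub>v y) = X *\<^sub>v x + Y *\<^sub>v y"
  unfolding append_cols_def using assms
  by (subst four_block_mat_mult_vec[of _ n m _ p _ 0]) (auto intro!: eq_vecI)

section \<open>Reduction of the preconditioned matrix to the pencil (H, W)\<close>

theorem theorem4p1:
  fixes n m p :: nat
    and A B C D P AA PP :: "real mat"
    and \<tau> \<theta> \<mu>_min \<mu>_max \<nu>_max \<Lambda>_lo \<Lambda>_up :: real
  assumes "0 < m" and "0 < p"
    and "spd_mat n A" and "spd_mat p D" and "spd_mat m P"
    and "B \<in> carrier_mat m n" and "vec_space.rank m B = m"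
    and "C \<in> carrier_mat p n"
    and "0 < \<tau>" and "0 < \<theta>"
    and "\<mu>_min = Min (spectrum (minv P * B * minv A * B\<^sup>T))"
    and "\<mu>_max = Max (spectrum (minv P * B * minv A * B\<^sup>T))"
    and "\<nu>_max = Max (spectrum (minv D * C * minv A * C\<^sup>T))"
    and "AA = block3_mat A (B\<^sup>T)     (C\<^sup>T)
                         B (0\<^sub>m m m) (0\<^sub>m m p)
                         C (0\<^sub>m p m) (- D)"
    and "PP = block3_mat A (0\<^sub>m n m)            (0\<^sub>m n p)
                         B ((- (1 / \<tau>)) \<cdot>\<^sub>m P) (0\<^sub>m m p)
                         C (0\<^sub>m p m)            ((- (1 / \<theta>)) \<cdot>\<^sub>m D)"
    and "\<Lambda>_lo = \<theta> * (1 + \<nu>_max) + \<tau> * \<mu>_min"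
    and "\<Lambda>_up = \<theta> * (1 + \<nu>_max) + \<tau> * \<mu>_max"
  shows "n \<le> count (eigvals_mset (minv PP * AA)) 1
    \<and> size (eigvals_mset (minv PP * AA) - replicate_mset n 1) = m + p
    \<and> (\<forall>z \<in># eigvals_mset (minv PP * AA) - replicate_mset n 1.
         \<exists>x \<in> {(\<Lambda>_lo - sqrt (\<Lambda>_lo\<^sup>2 - 4 * \<tau> * \<theta> * \<mu>_min)) / 2 ..
                (\<Lambda>_up + sqrt (\<Lambda>_up\<^sup>2 - 4 * \<tau> * \<theta> * \<mu>_max)) / 2}. z = complex_of_real x)"
proof -
  note m = \<open>0 < m\<close> and p = \<open>0 < p\<close> and A = \<open>spd_mat n A\<close> and D = \<open>spd_mat p D\<close> and P = \<open>spd_mat m P\<close>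
    and B = \<open>B \<in> carrier_mat m n\<close> and C = \<open>C \<in> carrier_mat p n\<close> and \<tau> = \<open>0 < \<tau>\<close> and \<theta> = \<open>0 < \<theta>\<close>
  have Ac: "A \<in> carrier_mat n n" and Dc: "D \<in> carrier_mat p p" "D\<^sup>T = D" and Pc: "P \<in> carrier_mat m m"
    using A D P by (auto simp: spd_mat_def)
  note detA = spd_det_nonzero[OF A]
  note Ai = minv_props[OF Ac detA] and Pi = minv_props[OF Pc spd_det_nonzero[OF P]]
    and Di = minv_props[OF Dc(1) spd_det_nonzero[OF D]]
  note psdAi = psd_minv[OF A]
  define S where "S = B * minv A * B\<^sup>T"
  define K where "K = C * minv A * C\<^sup>T"
  define F where "F = B @\<^sub>r C"
  define W where "W = four_block_mat ((1 / \<tau>) \<cdot>\<^sub>m P) (0\<^sub>m m p) (0\<^sub>m p m) ((1 / \<theta>) \<cdot>\<^sub>m D)"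
  define D' where "D' = four_block_mat (0\<^sub>m m m) (0\<^sub>m m p) (0\<^sub>m p m) D"
  define H where "H = F * minv A * F\<^sup>T + D'"
  define G where "G = minv W * H"
  note S = psd_congruence[OF psdAi B, folded S_def] and K = psd_congruence[OF psdAi C, folded K_def]
  have \<mu>_min: "\<mu>_min = Min (spectrum (minv P * S))" and \<mu>_max: "\<mu>_max = Max (spectrum (minv P * S))"
    and \<nu>_max: "\<nu>_max = Max (spectrum (minv D * K))"
    unfolding assms(11-13) S_def K_def using Ai(1) Pi(1) Di(1) B C
    by (simp_all add: assoc_mult_mat[of _ m m _ n _ n] assoc_mult_mat[of _ m m _ n _ m]
        assoc_mult_mat[of _ p p _ n _ n] assoc_mult_mat[of _ p p _ n _ p])
  have F: "F \<in> carrier_mat (m + p) n" unfolding F_def using B C by simp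
  have FT: "F\<^sup>T = B\<^sup>T @\<^sub>c C\<^sup>T" unfolding F_def by (rule transpose_append_rows[OF B C])
  have W: "spd_mat (m + p) W" unfolding W_def using P D \<tau> \<theta> by (intro spd_append) auto
  have Wc: "W \<in> carrier_mat (m + p) (m + p)" using W by (simp add: spd_mat_def)
  note detW = spd_det_nonzero[OF W]
  note Wi = minv_props[OF Wc detW]
  have D': "D' \<in> carrier_mat (m + p) (m + p)" "D'\<^sup>T = D'"
    unfolding D'_def using Dc by (auto simp: transpose_four_block_mat[of _ m m _ p _ p])
  have FAF: "F * minv A * F\<^sup>T \<in> carrier_mat (m + p) (m + p)" using F Ai by simp
  have H: "H \<in> carrier_mat (m + p) (m + p)" "H\<^sup>T = H"
    using psd_congruence(1)[OF psdAi F] D' FAF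
    by (auto simp: H_def psd_mat_def transpose_add[of _ "m + p" "m + p"])
  have G: "G \<in> carrier_mat (m + p) (m + p)" using Wi H by (simp add: G_def)
  have WG: "W * G = H"
    unfolding G_def using Wc Wi H by (simp flip: assoc_mult_mat[of _ "m + p" "m + p" _ "m + p" _ "m + p"])
  have AA: "AA = four_block_mat A (F\<^sup>T) F (- D')"
    unfolding assms(14) block3_mat_def FT F_def[symmetric]
    by (rule cong_four_block_mat) (use Dc in \<open>auto simp: D'_def intro!: eq_matI\<close>)
  have PP: "PP = four_block_mat A (0\<^sub>m n (m + p)) F (- W)"
    unfolding assms(15) block3_mat_def F_def[symmetric]
    by (rule cong_four_block_mat) (use Dc Pc in \<open>auto simp: W_def append_cols_def intro!: eq_matI\<close>)
  have "minv PP * AA = four_block_mat (1\<^sub>m n) (minv A * F\<^sup>T) (0\<^sub>m (m + p) n) G"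
    unfolding AA PP
  proof (rule minv_block_triangular_mult_saddle[OF Ac detA F _ Wc detW _ G])
    show "W * G = F * minv A * F\<^sup>T - - D'"
      unfolding WG H_def using FAF D' by (intro eq_matI) auto
  qed (use F D' in auto)
  then have eig: "eigvals_mset (minv PP * AA) = replicate_mset n 1 + eigvals_mset G"
    using eigvals_mset_block_one[OF _ G, of "minv A * F\<^sup>T" n] Ai F by simp
  \<comment> \<open>The left argument is a separate vector so that it can later be (x, 0) or (0, y)
    while the right one stays the eigenvector.\<close>
  have form: "(x' @\<^sub>v y') \<bullet> (H *\<^sub>v (x @\<^sub>v y))
      = (B\<^sup>T *\<^sub>v x' + C\<^sup>T *\<^sub>v y') \<bullet> (minv A *\<^sub>v (B\<^sup>T *\<^sub>v x + C\<^sup>T *\<^sub>v y)) + y' \<bullet> (D *\<^sub>v y)"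
    if c: "x \<in> carrier_vec m" "y \<in> carrier_vec p" "x' \<in> carrier_vec m" "y' \<in> carrier_vec p" for x y x' y'
  proof -
    have zero: "0\<^sub>m m m *\<^sub>v x = 0\<^sub>v m" using c by (intro eq_vecI) auto
    have "(x' @\<^sub>v y') \<bullet> (H *\<^sub>v (x @\<^sub>v y))
      = (x' @\<^sub>v y') \<bullet> ((F * minv A * F\<^sup>T) *\<^sub>v (x @\<^sub>v y)) + (x' @\<^sub>v y') \<bullet> (D' *\<^sub>v (x @\<^sub>v y))"
      unfolding H_def using FAF D' c
      by (simp add: add_mult_distrib_mat_vec[of _ "m + p" "m + p"] scalar_prod_add_distrib[of _ "m + p"])
    also have "(x' @\<^sub>v y') \<bullet> ((F * minv A * F\<^sup>T) *\<^sub>v (x @\<^sub>v y))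
      = (B\<^sup>T *\<^sub>v x' + C\<^sup>T *\<^sub>v y') \<bullet> (minv A *\<^sub>v (B\<^sup>T *\<^sub>v x + C\<^sup>T *\<^sub>v y))"
      using psd_congruence(2)[OF psdAi F, of "x' @\<^sub>v y'" "x @\<^sub>v y"] B C c
      by (simp add: FT append_cols_mult_vec[of _ n m _ p])
    also have "(x' @\<^sub>v y') \<bullet> (D' *\<^sub>v (x @\<^sub>v y)) = y' \<bullet> (D *\<^sub>v y)"
      unfolding D'_def using Dc c
      by (simp add: zero mult_mat_vec_split[of _ m _ p] scalar_prod_append[of _ m _ p])
    finally show ?thesis .
  qed
  have formW: "(x' @\<^sub>v y') \<bullet> (W *\<^sub>v (x @\<^sub>v y)) = (x' \<bullet> (P *\<^sub>v x)) / \<tau> + (y' \<bullet> (D *\<^sub>v y)) / \<theta>"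
    if c: "x \<in> carrier_vec m" "y \<in> carrier_vec p" "x' \<in> carrier_vec m" "y' \<in> carrier_vec p" for x y x' y'
    unfolding W_def using Dc Pc c
    by (simp add: mult_mat_vec_split[of _ m _ p] scalar_prod_append[of _ m _ p]
        smult_mat_mult_vec[of _ m m] smult_mat_mult_vec[of _ p p])
  have bounds: "\<exists>r \<in> {(\<Lambda>_lo - sqrt (\<Lambda>_lo\<^sup>2 - 4 * \<tau> * \<theta> * \<mu>_min)) / 2 ..
                (\<Lambda>_up + sqrt (\<Lambda>_up\<^sup>2 - 4 * \<tau> * \<theta> * \<mu>_max)) / 2}. z = complex_of_real r"
    if "z \<in># eigvals_mset G" for z
  proof -
    have "char_poly (map_mat complex_of_real G) \<noteq> 0"
      using degree_monic_char_poly[of "map_mat complex_of_real G" "m + p"] G by fastforce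
    then have "poly (char_poly (map_mat complex_of_real G)) z = 0"
      using that by (simp add: eigvals_mset_def)
    then obtain l v where z: "z = complex_of_real l" and v: "v \<in> carrier_vec (m + p)" "v \<noteq> 0\<^sub>v (m + p)"
      and Hv: "H *\<^sub>v v = l \<cdot>\<^sub>v (W *\<^sub>v v)"
      by (rule pencil_root_real[OF H W G WG])
    define x y where "x = vec_first v m" and "y = vec_last v p"
    have x: "x \<in> carrier_vec m" and y: "y \<in> carrier_vec p" and vxy: "v = x @\<^sub>v y"
      using v by (auto simp: x_def y_def)
    define g h where "g = B\<^sup>T *\<^sub>v x" and "h = C\<^sup>T *\<^sub>v y"
    have g: "g \<in> carrier_vec n" and h: "h \<in> carrier_vec n" using B C x y by (auto simp: g_def h_def)
    define a b s k e where "a = x \<bullet> (P *\<^sub>v x)" and "b = y \<bullet> (D *\<^sub>v y)" and "s = g \<bullet> (minv A *\<^sub>v g)"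
      and "k = h \<bullet> (minv A *\<^sub>v h)" and "e = g \<bullet> (minv A *\<^sub>v h)"
    have Aic: "minv A \<in> carrier_mat n n" "(minv A)\<^sup>T = minv A" using psdAi by (auto simp: psd_mat_def)
    have Agh: "minv A *\<^sub>v (g + h) = minv A *\<^sub>v g + minv A *\<^sub>v h"
      using Aic g h by (simp add: mult_add_distrib_mat_vec[of _ n n])
    have Aiv: "minv A *\<^sub>v g \<in> carrier_vec n" "minv A *\<^sub>v h \<in> carrier_vec n" using Aic g h by auto
    have zero: "C\<^sup>T *\<^sub>v 0\<^sub>v p = 0\<^sub>v n" "B\<^sup>T *\<^sub>v 0\<^sub>v m = 0\<^sub>v n"
      using B C by (auto intro!: eq_vecI)
    have HW: "w \<bullet> (H *\<^sub>v (x @\<^sub>v y)) = l * (w \<bullet> (W *\<^sub>v (x @\<^sub>v y)))" if "w \<in> carrier_vec (m + p)" for w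
      using Hv Wc that by (simp add: vxy)
    have "s + e = l * (a / \<tau>)"
      using HW[of "x @\<^sub>v 0\<^sub>v p"] form[OF x y x, of "0\<^sub>v p"] formW[OF x y x, of "0\<^sub>v p"] x y B C Dc g h Aiv
      by (simp add: zero g_def[symmetric] h_def[symmetric] Agh scalar_prod_add_distrib[of _ n] a_def s_def e_def)
    then have eq1: "\<tau> * (s + e) = l * a" using \<tau> by simp
    \<comment> \<open>Testing with (0, y) produces the cross term with \<open>g\<close> and
      \<open>h\<close> exchanged; symmetry of the inverse of \<open>A\<close> identifies it with
      \<open>e\<close>.\<close>
    have "e + k + b = l * (b / \<theta>)"
      using HW[of "0\<^sub>v m @\<^sub>v y"] form[OF x y _ y, of "0\<^sub>v m"] formW[OF x y _ y, of "0\<^sub>v m"] x y B C Pc g h Aiv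
        symmetric_form_commute[OF Aic g h]
      by (simp add: zero g_def[symmetric] h_def[symmetric] Agh scalar_prod_add_distrib[of _ n] b_def k_def e_def)
    then have eq2: "\<theta> * (e + k + b) = l * b" using \<theta> by simp
    have sx: "s = x \<bullet> (S *\<^sub>v x)" and ky: "k = y \<bullet> (K *\<^sub>v y)"
      using S(2)[OF x x] K(2)[OF y y] by (simp_all add: s_def k_def g_def h_def)
    have Sc: "S \<in> carrier_mat m m" "S\<^sup>T = S" and Kc: "K \<in> carrier_mat p p" "K\<^sup>T = K"
      using S(1) K(1) by (auto simp: psd_mat_def)
    have ab: "0 \<le> a" "0 \<le> b" using spd_imp_psd[OF P] spd_imp_psd[OF D] x y
      by (auto simp: a_def b_def psd_mat_def)
    have ab': "0 < a \<or> 0 < b"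
    proof -
      have "x \<noteq> 0\<^sub>v m \<or> y \<noteq> 0\<^sub>v p" using v(2) unfolding vxy by auto
      then show ?thesis using P D x y by (auto simp: a_def b_def spd_mat_def)
    qed
    have cs: "e\<^sup>2 \<le> s * k" unfolding e_def s_def k_def by (rule psd_cauchy_schwarz[OF psdAi g h])
    \<comment> \<open>The sum is the form of the inverse of \<open>A\<close> at g + h.\<close>
    have psd: "0 \<le> s + 2 * e + k"
      using psdAi g h form_lincomb[OF Aic g h, of 1 1]
      by (simp add: psd_mat_def s_def e_def k_def) (metis add_carrier_vec)
    have s: "0 \<le> s" "\<mu>_min * a \<le> s" "s \<le> \<mu>_max * a" and k: "0 \<le> k" "k \<le> \<nu>_max * b"
      using S(1) K(1) x y form_ge_Min_spectrum[OF Sc P x] form_le_Max_spectrum[OF Sc P x]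
        form_le_Max_spectrum[OF Kc D y]
      by (auto simp: sx ky \<mu>_min \<mu>_max \<nu>_max a_def b_def psd_mat_def)
    have nn: "0 \<le> \<mu>_max" "0 \<le> \<nu>_max"
      unfolding \<mu>_max \<nu>_max using spectrum_Max_nonneg S(1) K(1) P D m p by auto
    show ?thesis
      using compressed_eigenvalue_bounds[OF \<tau> \<theta> ab ab' eq1 eq2 cs psd s k nn] z
      unfolding assms(16,17) by auto
  qed
  \<comment> \<open>By \<open>eig\<close>, removing n ones leaves exactly the eigenvalues of
    \<open>G\<close>, even if 1 is also among those.\<close>
  show ?thesis using bounds size_eigvals_mset[OF G] by (simp add: eig)
qed

end
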